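(* Let $\gamma : I\to\mathbb{R}^3$ be a smooth curve on an open interval $I$ parametrized by arc length $s$, with nowhere vanishing curvature and unit tangent $T$. Let $c$ be a real constant with $c-s>0$ for all $s\in I$, and let $\widetilde\gamma=\gamma+(c-s)T$ be the involute of $\gamma$. Assume that $\widetilde\gamma$ is non-planar, in the sense that its torsion is nowhere zero. Then the binormal indicatrix of $\widetilde\gamma$ is a spherical helix if and only if the involute $\widetilde\gamma$ of $\gamma$ is a slant helix.
   Context: The binormal indicatrix of $\widetilde\gamma$ is the curve traced on the unit sphere by its unit binormal vector $\widetilde B$. For a curve with arc-length parameter $u$, curvature $k>0$ and torsion $t$, put $g=t/k$. The curve is a generalized helix if $g$ is constant (the value $0$ is allowed); a spherical helix is a generalized helix lying on the unit sphere. The curve is a slant helix if its principal normal lines make a constant angle with a fixed direction; equivalently (known characterization of Izumiya and Takeuchi), the function $\frac{dg/du}{k(1+g^2)^{3/2}}$ is constant. *)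

theory Defs
  imports "HOL-Analysis.Analysis"
begin

text \<open>
  A curve is a map \<open>real \<Rightarrow> real ^ 3\<close> considered on an open interval \<open>I\<close>; since \<open>I\<close> is open,
  the two-sided derivative \<open>at s\<close> is the right one at every point of \<open>I\<close>, and the values of the
  notions below outside \<open>I\<close> play no role.
\<close>

definition curve_deriv :: "(real \<Rightarrow> real ^ 3) \<Rightarrow> real \<Rightarrow> real ^ 3" where
  "curve_deriv \<beta> s = vector_derivative \<beta> (at s)"

text \<open>Infinitely often differentiable on the open set \<open>I\<close>.\<close>

definition smooth_curve_on :: "real set \<Rightarrow> (real \<Rightarrow> real ^ 3) \<Rightarrow> bool" where
  "smooth_curve_on I \<beta> \<longleftrightarrow> (\<forall>n. (curve_deriv ^^ n) \<beta> differentiable_on I)"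

text \<open>
  The Frenet apparatus of a regular curve \<open>\<beta>\<close> that need not be parametrized by arc length.
  If \<open>u\<close> is an arc-length parameter of \<open>\<beta>\<close>, then \<open>du/ds = norm (\<beta>' s)\<close>, so the derivative of
  a field \<open>X\<close> along \<open>\<beta>\<close> with respect to \<open>u\<close>, evaluated at the point with original
  parameter \<open>s\<close>, is \<open>X' s / norm (\<beta>' s)\<close>.  All quantities below are the usual arc-length ones,
  expressed as functions of the original parameter.
\<close>

definition arclength_deriv ::
    "(real \<Rightarrow> real ^ 3) \<Rightarrow> (real \<Rightarrow> real ^ 3) \<Rightarrow> real \<Rightarrow> real ^ 3" where
  "arclength_deriv \<beta> X s = curve_deriv X s /\<^sub>R norm (curve_deriv \<beta> s)"

definition unit_tangent :: "(real \<Rightarrow> real ^ 3) \<Rightarrow> real \<Rightarrow> real ^ 3" where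
  "unit_tangent \<beta> = arclength_deriv \<beta> \<beta>"

definition curvature :: "(real \<Rightarrow> real ^ 3) \<Rightarrow> real \<Rightarrow> real" where
  "curvature \<beta> s = norm (arclength_deriv \<beta> (unit_tangent \<beta>) s)"

definition principal_normal :: "(real \<Rightarrow> real ^ 3) \<Rightarrow> real \<Rightarrow> real ^ 3" where
  "principal_normal \<beta> s = arclength_deriv \<beta> (unit_tangent \<beta>) s /\<^sub>R curvature \<beta> s"

definition binormal :: "(real \<Rightarrow> real ^ 3) \<Rightarrow> real \<Rightarrow> real ^ 3" where
  "binormal \<beta> s = cross3 (unit_tangent \<beta> s) (principal_normal \<beta> s)"

text \<open>Sign convention: \<open>dB/du = - t N\<close>.\<close>

definition torsion :: "(real \<Rightarrow> real ^ 3) \<Rightarrow> real \<Rightarrow> real" where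
  "torsion \<beta> s = - inner (arclength_deriv \<beta> (binormal \<beta>) s) (principal_normal \<beta> s)"

text \<open>Regular smooth curves with nowhere vanishing curvature, i.e. those with a Frenet frame.\<close>

definition frenet_curve_on :: "real set \<Rightarrow> (real \<Rightarrow> real ^ 3) \<Rightarrow> bool" where
  "frenet_curve_on I \<beta> \<longleftrightarrow>
     smooth_curve_on I \<beta> \<and> (\<forall>s\<in>I. curve_deriv \<beta> s \<noteq> 0 \<and> curvature \<beta> s > 0)"

definition arclength_parametrized_on :: "real set \<Rightarrow> (real \<Rightarrow> real ^ 3) \<Rightarrow> bool" where
  "arclength_parametrized_on I \<beta> \<longleftrightarrow> (\<forall>s\<in>I. norm (curve_deriv \<beta> s) = 1)"

definition generalized_helix_on :: "real set \<Rightarrow> (real \<Rightarrow> real ^ 3) \<Rightarrow> bool" where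
  "generalized_helix_on I \<beta> \<longleftrightarrow>
     frenet_curve_on I \<beta> \<and> (\<exists>m. \<forall>s\<in>I. torsion \<beta> s / curvature \<beta> s = m)"

definition spherical_helix_on :: "real set \<Rightarrow> (real \<Rightarrow> real ^ 3) \<Rightarrow> bool" where
  "spherical_helix_on I \<beta> \<longleftrightarrow>
     generalized_helix_on I \<beta> \<and> (\<forall>s\<in>I. \<beta> s \<in> sphere 0 1)"

text \<open>The fixed direction is the unit vector \<open>d\<close>, the constant angle is \<open>\<theta>\<close>.\<close>

definition slant_helix_on :: "real set \<Rightarrow> (real \<Rightarrow> real ^ 3) \<Rightarrow> bool" where
  "slant_helix_on I \<beta> \<longleftrightarrow>
     frenet_curve_on I \<beta> \<and>
     (\<exists>d \<theta>. norm d = 1 \<and> (\<forall>s\<in>I. inner (principal_normal \<beta> s) d = cos \<theta>))"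

definition involute :: "real \<Rightarrow> (real \<Rightarrow> real ^ 3) \<Rightarrow> real \<Rightarrow> real ^ 3" where
  "involute c \<gamma> s = \<gamma> s + (c - s) *\<^sub>R unit_tangent \<gamma> s"

text \<open>The binormal indicatrix is the curve \<open>s \<mapsto> B s\<close>, with the parameter inherited from \<open>\<beta>\<close>.\<close>

abbreviation binormal_indicatrix :: "(real \<Rightarrow> real ^ 3) \<Rightarrow> real \<Rightarrow> real ^ 3" where
  "binormal_indicatrix \<beta> \<equiv> binormal \<beta>"

end

theory Submission
  imports Defs
begin

text \<open>
  The proof rests on one observation and one classical theorem. Let \<open>\<beta>\<close> be a regular curve with
  Frenet frame \<open>T, N, B\<close>, curvature \<open>k\<close>, torsion \<open>t\<close> and speed \<open>v\<close>. Since \<open>B' = - v t N\<close>, the unit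
  tangent of the binormal indicatrix is \<open>N\<close> up to the sign of \<open>t\<close>, and this sign is constant when \<open>t\<close>
  has no zero on the interval. Hence the principal normal of \<open>\<beta>\<close> makes a constant angle with a fixed
  direction if and only if the unit tangent of the binormal indicatrix does
  (\<open>unit_tangent_binormal_indicatrix\<close>). By Lancret's theorem (\<open>lancret\<close>) the latter says that the
  indicatrix is a generalized helix. It always lies on the unit sphere, so this is the
  equivalence for an arbitrary Frenet curve of nonvanishing torsion
  (\<open>binormal_indicatrix_spherical_helix_iff\<close>). The detour through the function
  \<open>g' / (k (1 + g\<^sup>2) powr (3/2))\<close> is thereby avoided.

  An involute enters only in that it is such a curve: the derivative of \<open>\<gamma> + (c - s) T\<close> is
  \<open>(c - s) k N\<close>, which does not vanish, so the unit tangent of the involute is the principal normal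
  \<open>N\<close> of \<open>\<gamma>\<close>, and \<open>N'\<close> does not vanish because its component along \<open>T\<close> is \<open>- k\<close>
  (\<open>frenet_curve_involute\<close>).

  Both notions of helix demand smoothness, so each curve constructed from the frame must be shown to
  be infinitely differentiable; a small calculus of smooth maps on an open subset of the line
  provides this.
\<close>

section \<open>Smooth maps on an open set of reals\<close>

text \<open>
  The derivative is quantified existentially rather than being \<open>vector_derivative\<close>. In this form the
  property visibly depends only on the values on the open set, and the closure properties below
  follow by induction once a formula for the first derivative is known.
\<close>

primrec times_differentiable_on :: "nat \<Rightarrow> real set \<Rightarrow> (real \<Rightarrow> 'a::real_normed_vector) \<Rightarrow> bool" where
  "times_differentiable_on 0 I f \<longleftrightarrow> True"
| "times_differentiable_on (Suc n) I f \<longleftrightarrow>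
     (\<exists>f'. (\<forall>s\<in>I. (f has_vector_derivative f' s) (at s)) \<and> times_differentiable_on n I f')"

definition smooth_on :: "real set \<Rightarrow> (real \<Rightarrow> 'a::real_normed_vector) \<Rightarrow> bool" where
  "smooth_on I f \<longleftrightarrow> (\<forall>n. times_differentiable_on n I f)"

lemma times_differentiable_on_SucD:
  "times_differentiable_on (Suc n) I f \<Longrightarrow> times_differentiable_on n I f"
proof (induction n arbitrary: f)
  case 0
  then show ?case by simp
next
  case (Suc n)
  then show ?case by (metis times_differentiable_on.simps(2))
qed

lemma has_vector_derivative_cong_open:
  assumes "open I" "s \<in> I" "\<And>x. x \<in> I \<Longrightarrow> f x = g x" "(f has_vector_derivative D) (at s)"
  shows "(g has_vector_derivative D) (at s)"
  using has_vector_derivative_transform_within_open[OF assms(4,1,2)] assms(3) by blast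

lemma times_differentiable_on_cong:
  assumes "open I" "\<And>x. x \<in> I \<Longrightarrow> f x = g x" "times_differentiable_on n I f"
  shows "times_differentiable_on n I g"
proof (cases n)
  case 0
  then show ?thesis by simp
next
  case (Suc m)
  then obtain f' where "\<forall>s\<in>I. (f has_vector_derivative f' s) (at s)"
    and "times_differentiable_on m I f'"
    using assms(3) by auto
  moreover from this have "\<forall>s\<in>I. (g has_vector_derivative f' s) (at s)"
    using has_vector_derivative_cong_open[of I _ f g] assms(1,2) by blast
  ultimately show ?thesis using Suc by auto
qed

lemma times_differentiable_on_const: "times_differentiable_on n I (\<lambda>_. a)"
proof (induction n arbitrary: a)
  case (Suc n)
  have "\<forall>s\<in>I. ((\<lambda>_. a) has_vector_derivative 0) (at s)" by simp
  with Suc[of 0] show ?case by (metis times_differentiable_on.simps(2))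
qed simp

lemma times_differentiable_on_add:
  assumes "times_differentiable_on n I f" "times_differentiable_on n I g"
  shows "times_differentiable_on n I (\<lambda>s. f s + g s)"
  using assms
proof (induction n arbitrary: f g)
  case (Suc n)
  from Suc.prems obtain f' g' where
    "\<forall>s\<in>I. (f has_vector_derivative f' s) (at s)" "times_differentiable_on n I f'"
    "\<forall>s\<in>I. (g has_vector_derivative g' s) (at s)" "times_differentiable_on n I g'" by auto
  then show ?case
    using Suc.IH[of f' g']
    by (auto intro!: exI[of _ "\<lambda>s. f' s + g' s"] has_vector_derivative_add)
qed simp

lemma times_differentiable_on_bilinear:
  assumes "bounded_bilinear p"
    and "times_differentiable_on n I f" "times_differentiable_on n I g"
  shows "times_differentiable_on n I (\<lambda>s. p (f s) (g s))"
  using assms(2,3)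
proof (induction n arbitrary: f g)
  case (Suc n)
  from Suc.prems obtain f' g' where
    *: "\<forall>s\<in>I. (f has_vector_derivative f' s) (at s)" "times_differentiable_on n I f'"
    "\<forall>s\<in>I. (g has_vector_derivative g' s) (at s)" "times_differentiable_on n I g'" by auto
  have "times_differentiable_on n I (\<lambda>s. p (f s) (g' s) + p (f' s) (g s))"
    using Suc.IH * Suc.prems[THEN times_differentiable_on_SucD]
    by (intro times_differentiable_on_add) auto
  moreover have "\<forall>s\<in>I. ((\<lambda>s. p (f s) (g s)) has_vector_derivative
      (p (f s) (g' s) + p (f' s) (g s))) (at s)"
    using * bounded_bilinear.has_vector_derivative[OF assms(1)] by blast
  ultimately show ?case
    by (auto intro!: exI[of _ "\<lambda>s. p (f s) (g' s) + p (f' s) (g s)"])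
qed simp

lemmas times_differentiable_on_mult = times_differentiable_on_bilinear[OF bounded_bilinear_mult]

text \<open>
  The derivatives of the reciprocal and of the square root are polynomials in the reciprocal (of the
  function, respectively of its root) and the derivative of the inner function; the induction
  therefore closes on itself.
\<close>

lemma times_differentiable_on_inverse:
  fixes f :: "real \<Rightarrow> real"
  assumes "times_differentiable_on n I f" "\<And>s. s \<in> I \<Longrightarrow> f s \<noteq> 0"
  shows "times_differentiable_on n I (\<lambda>s. inverse (f s))"
  using assms
proof (induction n arbitrary: f)
  case (Suc n)
  from Suc.prems obtain f' where
    *: "\<forall>s\<in>I. (f has_vector_derivative f' s) (at s)" "times_differentiable_on n I f'" by auto
  have i: "times_differentiable_on n I (\<lambda>s. inverse (f s))"
    using Suc.IH Suc.prems times_differentiable_on_SucD by blast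
  have "times_differentiable_on n I (\<lambda>s. (- 1) * (inverse (f s) * (f' s * inverse (f s))))"
    by (intro times_differentiable_on_mult times_differentiable_on_const i *)
  moreover have "\<forall>s\<in>I. ((\<lambda>s. inverse (f s)) has_vector_derivative
      ((- 1) * (inverse (f s) * (f' s * inverse (f s))))) (at s)"
    using * Suc.prems(2)
    by (auto simp: has_real_derivative_iff_has_vector_derivative[symmetric]
        intro!: derivative_eq_intros)
  ultimately show ?case
    by (auto intro!: exI[of _ "\<lambda>s. (- 1) * (inverse (f s) * (f' s * inverse (f s)))"])
qed simp

lemma times_differentiable_on_sqrt:
  fixes f :: "real \<Rightarrow> real"
  assumes "times_differentiable_on n I f" "\<And>s. s \<in> I \<Longrightarrow> f s > 0"
  shows "times_differentiable_on n I (\<lambda>s. sqrt (f s))"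
  using assms
proof (induction n arbitrary: f)
  case (Suc n)
  from Suc.prems obtain f' where
    *: "\<forall>s\<in>I. (f has_vector_derivative f' s) (at s)" "times_differentiable_on n I f'" by auto
  have "times_differentiable_on n I (\<lambda>s. sqrt (f s))"
    using Suc.IH Suc.prems times_differentiable_on_SucD by blast
  then have i: "times_differentiable_on n I (\<lambda>s. inverse (sqrt (f s)))"
    using Suc.prems(2) by (intro times_differentiable_on_inverse) force+
  have "times_differentiable_on n I (\<lambda>s. f' s * (inverse (sqrt (f s)) * (1 / 2)))"
    by (intro times_differentiable_on_mult times_differentiable_on_const i *)
  moreover have "\<forall>s\<in>I. ((\<lambda>s. sqrt (f s)) has_vector_derivative
      (f' s * (inverse (sqrt (f s)) * (1 / 2)))) (at s)"
  proof
    fix s assume s: "s \<in> I"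
    have "(f has_real_derivative f' s) (at s)"
      using * s by (simp add: has_real_derivative_iff_has_vector_derivative)
    then have "((\<lambda>s. sqrt (f s)) has_real_derivative inverse (sqrt (f s)) / 2 * f' s) (at s)"
      using DERIV_real_sqrt[OF Suc.prems(2)[OF s]] by (rule DERIV_chain2[rotated])
    then show "((\<lambda>s. sqrt (f s)) has_vector_derivative
        (f' s * (inverse (sqrt (f s)) * (1 / 2)))) (at s)"
      by (simp add: has_real_derivative_iff_has_vector_derivative mult.commute)
  qed
  ultimately show ?case
    by (auto intro!: exI[of _ "\<lambda>s. f' s * (inverse (sqrt (f s)) * (1 / 2))"])
qed simp

lemma smooth_on_const: "smooth_on I (\<lambda>_. a)"
  by (simp add: smooth_on_def times_differentiable_on_const)

lemma smooth_on_ident: "smooth_on I (\<lambda>s. s)"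
  unfolding smooth_on_def
proof
  show "times_differentiable_on n I (\<lambda>s. s)" for n
    by (cases n) (auto intro!: exI[of _ "\<lambda>_. 1"] times_differentiable_on_const
        has_vector_derivative_id)
qed

lemma smooth_on_add: "smooth_on I f \<Longrightarrow> smooth_on I g \<Longrightarrow> smooth_on I (\<lambda>s. f s + g s)"
  by (simp add: smooth_on_def times_differentiable_on_add)

lemma smooth_on_bilinear:
  "bounded_bilinear p \<Longrightarrow> smooth_on I f \<Longrightarrow> smooth_on I g \<Longrightarrow> smooth_on I (\<lambda>s. p (f s) (g s))"
  by (simp add: smooth_on_def times_differentiable_on_bilinear)

lemmas smooth_on_scaleR = smooth_on_bilinear[OF bounded_bilinear_scaleR]
lemmas smooth_on_inner = smooth_on_bilinear[OF bounded_bilinear_inner]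
lemmas smooth_on_mult = smooth_on_bilinear[OF bounded_bilinear_mult]

lemma bounded_bilinear_cross3: "bounded_bilinear cross3"
  using bilinear_conv_bounded_bilinear bilinear_cross by blast

lemmas smooth_on_cross3 = smooth_on_bilinear[OF bounded_bilinear_cross3]

lemma smooth_on_inverse:
  fixes f :: "real \<Rightarrow> real"
  shows "smooth_on I f \<Longrightarrow> (\<And>s. s \<in> I \<Longrightarrow> f s \<noteq> 0) \<Longrightarrow> smooth_on I (\<lambda>s. inverse (f s))"
  by (simp add: smooth_on_def times_differentiable_on_inverse)

lemma smooth_on_norm:
  fixes f :: "real \<Rightarrow> 'a::real_inner"
  assumes "smooth_on I f" "\<And>s. s \<in> I \<Longrightarrow> f s \<noteq> 0"
  shows "smooth_on I (\<lambda>s. norm (f s))"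
proof -
  have "smooth_on I (\<lambda>s. inner (f s) (f s))"
    by (rule smooth_on_inner[OF assms(1) assms(1)])
  then show ?thesis
    using assms(2) by (simp add: smooth_on_def times_differentiable_on_sqrt norm_eq_sqrt_inner)
qed

lemma smooth_on_has_curve_deriv:
  assumes "smooth_on I f" "s \<in> I"
  shows "(f has_vector_derivative curve_deriv f s) (at s)"
proof -
  have "times_differentiable_on (Suc 0) I f"
    using assms(1) unfolding smooth_on_def by blast
  then show ?thesis
    using assms(2) by (auto simp: curve_deriv_def vector_derivative_at)
qed

lemma curve_deriv_eqI: "(f has_vector_derivative D) (at s) \<Longrightarrow> curve_deriv f s = D"
  by (simp add: curve_deriv_def vector_derivative_at)

lemma curve_deriv_const: "curve_deriv (\<lambda>_. a) s = 0"
  by (simp add: curve_deriv_eqI)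

lemma times_differentiable_on_curve_deriv:
  assumes "open I" "times_differentiable_on (Suc n) I f"
  shows "times_differentiable_on n I (curve_deriv f)"
proof -
  obtain f' where "\<forall>s\<in>I. (f has_vector_derivative f' s) (at s)" "times_differentiable_on n I f'"
    using assms(2) by auto
  then show ?thesis
    using times_differentiable_on_cong[OF assms(1), of f' "curve_deriv f"] curve_deriv_eqI by metis
qed

lemma smooth_on_curve_deriv: "open I \<Longrightarrow> smooth_on I f \<Longrightarrow> smooth_on I (curve_deriv f)"
  unfolding smooth_on_def using times_differentiable_on_curve_deriv by blast

lemma smooth_on_continuous_on: "smooth_on I f \<Longrightarrow> continuous_on I f"
proof -
  assume "smooth_on I f"
  then have "times_differentiable_on (Suc 0) I f"
    unfolding smooth_on_def by blast
  then obtain f' where "\<forall>s\<in>I. (f has_vector_derivative f' s) (at s)" by auto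
  then show ?thesis
    by (meson continuous_at_imp_continuous_on has_vector_derivative_continuous)
qed

lemma smooth_curve_on_iff_smooth_on:
  assumes "open I"
  shows "smooth_curve_on I f \<longleftrightarrow> smooth_on I f"
proof
  assume *: "smooth_curve_on I f"
  have "times_differentiable_on n I ((curve_deriv ^^ m) f)" for n m
  proof (induction n arbitrary: m)
    case (Suc n)
    have "(curve_deriv ^^ m) f differentiable_on I"
      using * by (simp add: smooth_curve_on_def)
    then have "\<forall>s\<in>I. ((curve_deriv ^^ m) f has_vector_derivative
        (curve_deriv ^^ Suc m) f s) (at s)"
      using assms
      by (simp add: differentiable_on_eq_differentiable_at curve_deriv_def
          vector_derivative_works[symmetric])
    with Suc[of "Suc m"] show ?case
      by (metis times_differentiable_on.simps(2))
  qed simp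
  from this[of _ 0] show "smooth_on I f" by (simp add: smooth_on_def)
next
  assume *: "smooth_on I f"
  have "smooth_on I ((curve_deriv ^^ n) f)" for n
    by (induction n) (use * smooth_on_curve_deriv[OF assms] in auto)
  then show "smooth_curve_on I f"
    unfolding smooth_curve_on_def
    by (meson differentiableI_vector differentiable_at_imp_differentiable_on
        smooth_on_has_curve_deriv)
qed

text \<open>
  Differentiating a constant inner product; applied to the orthonormality relations of the frame
  this gives the skew symmetry of the Frenet equations.
\<close>

lemma inner_curve_deriv_const:
  assumes "open I" "smooth_on I f" "smooth_on I g" "\<And>x. x \<in> I \<Longrightarrow> inner (f x) (g x) = a" "s \<in> I"
  shows "inner (f s) (curve_deriv g s) + inner (curve_deriv f s) (g s) = 0"
proof -
  have "((\<lambda>x. inner (f x) (g x)) has_vector_derivative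
      (inner (f s) (curve_deriv g s) + inner (curve_deriv f s) (g s))) (at s)"
    by (rule bounded_bilinear.has_vector_derivative[OF bounded_bilinear_inner
          smooth_on_has_curve_deriv[OF assms(2,5)] smooth_on_has_curve_deriv[OF assms(3,5)]])
  then have "((\<lambda>x. a) has_vector_derivative
      (inner (f s) (curve_deriv g s) + inner (curve_deriv f s) (g s))) (at s)"
    by (rule has_vector_derivative_cong_open[OF assms(1,5), rotated]) (rule assms(4))
  then show ?thesis
    by (metis has_vector_derivative_const vector_derivative_unique_at)
qed

lemma constant_on_interval:
  fixes f :: "real \<Rightarrow> 'a::real_normed_vector"
  assumes "is_interval I" "\<And>s. s \<in> I \<Longrightarrow> (f has_vector_derivative 0) (at s)"
  obtains a where "\<And>s. s \<in> I \<Longrightarrow> f s = a"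
proof (rule has_vector_derivative_zero_constant[of I f])
  show "convex I" using assms(1) by (rule is_interval_convex)
qed (auto intro: assms(2) has_vector_derivative_at_within that)

section \<open>The Frenet frame\<close>

text \<open>
  The parameter need not be arc length, because neither the involute nor its binormal indicatrix
  has unit speed in general when the parameter of \<open>\<gamma>\<close> is kept. Hence each Frenet equation carries the speed \<open>v\<close> as a
  factor.
\<close>

locale frenet_curve =
  fixes I :: "real set" and \<beta> :: "real \<Rightarrow> real ^ 3"
  assumes open_I: "open I" and frenet: "frenet_curve_on I \<beta>"
begin

abbreviation "v s \<equiv> norm (curve_deriv \<beta> s)"
abbreviation "k \<equiv> curvature \<beta>"
abbreviation "t \<equiv> torsion \<beta>"
abbreviation "T \<equiv> unit_tangent \<beta>"
abbreviation "N \<equiv> principal_normal \<beta>"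
abbreviation "B \<equiv> binormal \<beta>"

lemma speed_pos: "s \<in> I \<Longrightarrow> v s > 0"
  and curvature_pos: "s \<in> I \<Longrightarrow> k s > 0"
  using frenet by (auto simp: frenet_curve_on_def)

lemma smooth: "smooth_on I \<beta>"
  using frenet open_I smooth_curve_on_iff_smooth_on by (auto simp: frenet_curve_on_def)

lemma smooth_arclength_deriv: "smooth_on I X \<Longrightarrow> smooth_on I (arclength_deriv \<beta> X)"
  unfolding arclength_deriv_def
  using speed_pos
  by (intro smooth_on_scaleR smooth_on_inverse smooth_on_norm smooth_on_curve_deriv open_I smooth)
    auto

lemma smooth_unit_tangent: "smooth_on I T"
  unfolding unit_tangent_def by (rule smooth_arclength_deriv[OF smooth])

lemma smooth_curvature: "smooth_on I k"
proof -
  have "smooth_on I (\<lambda>s. norm (arclength_deriv \<beta> T s))"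
    using curvature_pos
    by (intro smooth_on_norm smooth_arclength_deriv smooth_unit_tangent)
      (force simp: curvature_def)
  then show ?thesis by (simp add: curvature_def[abs_def])
qed

lemma smooth_principal_normal: "smooth_on I N"
proof -
  have "smooth_on I (\<lambda>s. arclength_deriv \<beta> T s /\<^sub>R k s)"
    using curvature_pos
    by (intro smooth_on_scaleR smooth_on_inverse smooth_curvature smooth_arclength_deriv
        smooth_unit_tangent) force
  then show ?thesis by (simp add: principal_normal_def[abs_def])
qed

lemma smooth_binormal: "smooth_on I B"
  unfolding binormal_def[abs_def]
  by (rule smooth_on_cross3[OF smooth_unit_tangent smooth_principal_normal])

lemma continuous_torsion: "continuous_on I t"
  unfolding torsion_def[abs_def]
  by (intro continuous_on_minus continuous_on_inner smooth_on_continuous_on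
      smooth_arclength_deriv smooth_binormal smooth_principal_normal)

lemma curve_deriv_unit_tangent: "s \<in> I \<Longrightarrow> curve_deriv T s = (v s * k s) *\<^sub>R N s"
  using speed_pos[of s] curvature_pos[of s] right_inverse[of "v s * k s"]
  by (simp add: principal_normal_def arclength_deriv_def inverse_mult_distrib mult.commute)

lemma inner_unit_tangent_self: "s \<in> I \<Longrightarrow> inner (T s) (T s) = 1"
  using speed_pos[of s]
  by (simp add: unit_tangent_def arclength_deriv_def power2_norm_eq_inner[symmetric]
      power_mult_distrib[symmetric] dot_square_norm)

lemma norm_principal_normal: "s \<in> I \<Longrightarrow> norm (N s) = 1"
  using curvature_pos[of s] by (simp add: principal_normal_def curvature_def)

lemma inner_principal_normal_self: "s \<in> I \<Longrightarrow> inner (N s) (N s) = 1"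
  by (simp add: norm_principal_normal dot_square_norm)

lemma inner_unit_tangent_principal_normal: "s \<in> I \<Longrightarrow> inner (T s) (N s) = 0"
  using inner_curve_deriv_const[OF open_I smooth_unit_tangent smooth_unit_tangent
      inner_unit_tangent_self, of s] speed_pos[of s] curvature_pos[of s]
  by (simp add: curve_deriv_unit_tangent inner_commute[of "N s"])

lemma inner_unit_tangent_binormal: "inner (T s) (B s) = 0"
  and inner_principal_normal_binormal: "inner (N s) (B s) = 0"
  by (simp_all add: binormal_def dot_cross_self)

lemma inner_binormal_self: "s \<in> I \<Longrightarrow> inner (B s) (B s) = 1"
  by (simp add: binormal_def dot_cross inner_unit_tangent_self inner_principal_normal_self
      inner_unit_tangent_principal_normal inner_commute[of "N s" "T s"])

text \<open>
  The double product \<open>B \<times> (x \<times> B)\<close> equals \<open>x - (x \<bullet> B) B\<close> by Lagrange's identity. Inserting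
  \<open>B = T \<times> N\<close> in the inner product first expresses it through \<open>B \<times> T = N\<close> and \<open>B \<times> N = - T\<close>.
\<close>

lemma frame_expansion:
  assumes "s \<in> I" and coords: "inner x (T s) = a" "inner x (N s) = b" "inner x (B s) = c"
  shows "x = a *\<^sub>R T s + b *\<^sub>R N s + c *\<^sub>R B s"
proof -
  have BT: "cross3 (B s) (T s) = N s"
    using assms(1) cross_skew[of "B s" "T s"]
    by (simp add: binormal_def Lagrange inner_unit_tangent_self
        inner_unit_tangent_principal_normal)
  have "cross3 (B s) (N s) = - cross3 (N s) (cross3 (T s) (N s))"
    by (subst cross_skew) (simp only: binormal_def)
  also have "\<dots> = - T s"
    using assms(1) inner_unit_tangent_principal_normal[OF assms(1)]
    by (simp add: Lagrange inner_principal_normal_self inner_commute[of "N s" "T s"])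
  finally have BN: "cross3 (B s) (N s) = - T s" .
  have "x - inner x (B s) *\<^sub>R B s = cross3 (B s) (cross3 x (B s))"
    by (simp add: Lagrange inner_binormal_self[OF assms(1)] inner_commute[of "B s" x])
  also have "\<dots> = cross3 (B s) (inner x (N s) *\<^sub>R T s - inner x (T s) *\<^sub>R N s)"
    by (simp add: binormal_def[of \<beta> s] Lagrange[of x])
  also have "\<dots> = inner x (N s) *\<^sub>R N s + inner x (T s) *\<^sub>R T s"
    by (simp add: Cross3.right_diff_distrib cross_mult_right BT BN)
  finally show ?thesis by (simp add: coords algebra_simps)
qed

text \<open>
  Since \<open>T'\<close> is parallel to \<open>N\<close>, the product rule leaves \<open>B' = T \<times> N'\<close>, which is orthogonal to \<open>T\<close>; it is
  orthogonal to the unit vector \<open>B\<close> as well, so only the component along \<open>N\<close> remains.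
\<close>

lemma curve_deriv_binormal:
  assumes "s \<in> I"
  shows "curve_deriv B s = - (v s * t s) *\<^sub>R N s"
proof -
  have "(B has_vector_derivative
      (cross3 (T s) (curve_deriv N s) + cross3 (curve_deriv T s) (N s))) (at s)"
    unfolding binormal_def[abs_def]
    by (rule bounded_bilinear.has_vector_derivative[OF bounded_bilinear_cross3
          smooth_on_has_curve_deriv[OF smooth_unit_tangent assms]
          smooth_on_has_curve_deriv[OF smooth_principal_normal assms]])
  then have "curve_deriv B s = cross3 (T s) (curve_deriv N s)"
    using assms by (simp add: curve_deriv_eqI curve_deriv_unit_tangent cross_mult_left)
  then have 1: "inner (curve_deriv B s) (T s) = 0"
    by (simp add: dot_cross_self)
  have 3: "inner (curve_deriv B s) (B s) = 0"
    using inner_curve_deriv_const[OF open_I smooth_binormal smooth_binormal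
        inner_binormal_self assms] by (simp add: inner_commute)
  have 2: "inner (curve_deriv B s) (N s) = - (v s * t s)"
    using speed_pos[OF assms] by (simp add: torsion_def arclength_deriv_def)
  show ?thesis
    using frame_expansion[OF assms 1 2 3] by simp
qed

text \<open>By skew symmetry, the components of \<open>N'\<close> along \<open>T\<close> and \<open>B\<close> are those of \<open>- T'\<close> and \<open>- B'\<close> along \<open>N\<close>.\<close>

lemma curve_deriv_principal_normal:
  assumes "s \<in> I"
  shows "curve_deriv N s = v s *\<^sub>R (t s *\<^sub>R B s - k s *\<^sub>R T s)"
proof -
  have 1: "inner (curve_deriv N s) (T s) = - (v s * k s)"
    using inner_curve_deriv_const[OF open_I smooth_principal_normal smooth_unit_tangent, of 0 s]
      assms inner_unit_tangent_principal_normal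
    by (simp add: inner_commute curve_deriv_unit_tangent inner_principal_normal_self)
  have 2: "inner (curve_deriv N s) (N s) = 0"
    using inner_curve_deriv_const[OF open_I smooth_principal_normal smooth_principal_normal
        inner_principal_normal_self assms] by (simp add: inner_commute)
  have 3: "inner (curve_deriv N s) (B s) = v s * t s"
    using inner_curve_deriv_const[OF open_I smooth_principal_normal smooth_binormal
        inner_principal_normal_binormal assms] assms
    by (simp add: curve_deriv_binormal inner_principal_normal_self)
  show ?thesis
    using frame_expansion[OF assms 1 2 3] by (simp add: algebra_simps)
qed

lemma curve_deriv_principal_normal_nonzero:
  assumes "s \<in> I"
  shows "curve_deriv N s \<noteq> 0"
proof
  assume "curve_deriv N s = 0"
  then have "inner (t s *\<^sub>R B s - k s *\<^sub>R T s) (T s) = 0"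
    using speed_pos[OF assms] by (simp add: curve_deriv_principal_normal[OF assms])
  moreover have "inner (B s) (T s) = 0"
    using inner_unit_tangent_binormal[of s] by (simp only: inner_commute)
  ultimately show False
    using curvature_pos[OF assms]
    by (simp add: inner_diff_left inner_unit_tangent_self[OF assms])
qed

end

section \<open>Lancret's theorem\<close>

text \<open>
  If \<open>t / k = m\<close>, the vector \<open>m T + B\<close> has derivative \<open>v (m k - t) N = 0\<close> and is the axis. Conversely, if
  \<open>T \<bullet> d\<close> is constant, then \<open>N \<bullet> d = 0\<close>, hence \<open>B \<bullet> d\<close> is constant as well, and differentiating
  \<open>N \<bullet> d = 0\<close> yields \<open>t (B \<bullet> d) = k (T \<bullet> d)\<close>; here \<open>B \<bullet> d\<close> is not zero, as otherwise \<open>d\<close> would be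
  orthogonal to the whole frame.
\<close>

lemma lancret:
  assumes "open I" "is_interval I" "frenet_curve_on I \<beta>"
  shows "generalized_helix_on I \<beta> \<longleftrightarrow>
    (\<exists>d \<theta>. norm d = 1 \<and> (\<forall>s\<in>I. inner (unit_tangent \<beta> s) d = cos \<theta>))"
proof -
  interpret frenet_curve I \<beta> using assms by unfold_locales
  show ?thesis
  proof
    assume "generalized_helix_on I \<beta>"
    then obtain m where m: "\<And>s. s \<in> I \<Longrightarrow> t s / k s = m"
      unfolding generalized_helix_on_def by blast
    have "((\<lambda>s. m *\<^sub>R T s + B s) has_vector_derivative 0) (at s)" if "s \<in> I" for s
    proof -
      have "((\<lambda>s. m *\<^sub>R T s + B s) has_vector_derivative
          (m *\<^sub>R curve_deriv T s + curve_deriv B s)) (at s)"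
        by (intro has_vector_derivative_add bounded_linear.has_vector_derivative[OF
              bounded_linear_scaleR_right] smooth_on_has_curve_deriv[OF _ that]
            smooth_unit_tangent smooth_binormal)
      moreover have "m *\<^sub>R curve_deriv T s + curve_deriv B s = 0"
        using m[OF that] curvature_pos[OF that]
        by (simp add: curve_deriv_unit_tangent curve_deriv_binormal that field_simps)
      ultimately show ?thesis by simp
    qed
    then obtain w where w: "\<And>s. s \<in> I \<Longrightarrow> m *\<^sub>R T s + B s = w"
      using constant_on_interval[OF assms(2)] by blast
    show "\<exists>d \<theta>. norm d = 1 \<and> (\<forall>s\<in>I. inner (T s) d = cos \<theta>)"
    proof (cases "I = {}")
      case True
      \<comment> \<open>Here \<open>w\<close> is arbitrary, possibly zero, and cannot serve as the axis.\<close>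
      then show ?thesis using norm_axis_1 by blast
    next
      case False
      then obtain s0 where s0: "s0 \<in> I" by blast
      have "inner w w = m * m + 1"
        using s0 inner_unit_tangent_binormal[of s0]
        by (simp add: w[symmetric, OF s0] inner_add_left inner_add_right inner_commute
            inner_unit_tangent_self inner_binormal_self)
      moreover have "m * m + 1 > 0" by (simp add: add_nonneg_pos)
      ultimately have w0: "w \<noteq> 0" by auto
      define d where "d = w /\<^sub>R norm w"
      have d: "norm d = 1" using w0 by (simp add: d_def)
      have Td: "inner (T s) d = m / norm w" if "s \<in> I" for s
        using that inner_unit_tangent_binormal[of s]
        by (simp add: d_def w[symmetric, OF that] inner_add_right inner_unit_tangent_self
            divide_inverse_commute)
      \<comment> \<open>The constant has to be a cosine.\<close>
      have "\<bar>inner (T s0) d\<bar> \<le> norm (T s0) * norm d"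
        by (rule Cauchy_Schwarz_ineq2)
      then have "\<bar>m / norm w\<bar> \<le> 1"
        using d Td[OF s0] inner_unit_tangent_self[OF s0] by (simp add: norm_eq_sqrt_inner)
      then have "cos (arccos (m / norm w)) = m / norm w" by (simp add: cos_arccos_abs)
      with d Td show ?thesis by metis
    qed
  next
    assume "\<exists>d \<theta>. norm d = 1 \<and> (\<forall>s\<in>I. inner (T s) d = cos \<theta>)"
    then obtain d \<theta> where d: "norm d = 1" and Td: "\<And>s. s \<in> I \<Longrightarrow> inner (T s) d = cos \<theta>" by blast
    have Nd: "inner (N s) d = 0" if "s \<in> I" for s
      using inner_curve_deriv_const[OF assms(1) smooth_unit_tangent smooth_on_const Td that]
        speed_pos[OF that] curvature_pos[OF that]
      by (simp add: curve_deriv_unit_tangent that curve_deriv_const)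
    have "((\<lambda>s. inner (B s) d) has_vector_derivative 0) (at s)" if "s \<in> I" for s
    proof -
      have "((\<lambda>s. inner (B s) d) has_vector_derivative inner (curve_deriv B s) d) (at s)"
        by (intro bounded_linear.has_vector_derivative[OF bounded_linear_inner_left]
            smooth_on_has_curve_deriv[OF smooth_binormal that])
      then show ?thesis by (simp add: curve_deriv_binormal that Nd)
    qed
    then obtain b where Bd: "\<And>s. s \<in> I \<Longrightarrow> inner (B s) d = b"
      using constant_on_interval[OF assms(2)] by blast
    have ratio: "t s * b = k s * cos \<theta>" if "s \<in> I" for s
      using inner_curve_deriv_const[OF assms(1) smooth_principal_normal smooth_on_const Nd that]
        speed_pos[OF that]
      by (simp add: curve_deriv_principal_normal that inner_diff_left Bd Td curve_deriv_const)
    have "t s / k s = cos \<theta> / b" if "s \<in> I" for s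
    proof -
      have "b \<noteq> 0"
      proof
        assume "b = 0"
        then have "cos \<theta> = 0" using ratio[OF that] curvature_pos[OF that] by simp
        then have "d = 0"
          using frame_expansion[OF that, of d 0 0 0] Td[OF that] Nd[OF that] Bd[OF that] \<open>b = 0\<close>
          by (simp add: inner_commute)
        then show False using d by simp
      qed
      then show ?thesis using ratio[OF that] curvature_pos[OF that] by (simp add: field_simps)
    qed
    then show "generalized_helix_on I \<beta>"
      using assms(3) unfolding generalized_helix_on_def by blast
  qed
qed

section \<open>The binormal indicatrix\<close>

text \<open>
  Differentiating \<open>B\<close> gives \<open>- v t N\<close>. The sign \<open>e\<close> is that of \<open>- t\<close>, and it is the same on all of \<open>I\<close>
  because \<open>t\<close> is continuous and has no zero on the interval.
\<close>

lemma unit_tangent_binormal_indicatrix: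
  assumes "open I" "is_interval I" "frenet_curve_on I \<beta>" "\<And>s. s \<in> I \<Longrightarrow> torsion \<beta> s \<noteq> 0"
  obtains e :: real where "e * e = 1"
    and "\<And>s. s \<in> I \<Longrightarrow> unit_tangent (binormal \<beta>) s = e *\<^sub>R principal_normal \<beta> s"
proof -
  interpret frenet_curve I \<beta> using assms by unfold_locales
  have tangent: "unit_tangent B s = (- sgn (t s)) *\<^sub>R N s" if "s \<in> I" for s
    using that speed_pos[OF that] assms(4)[OF that]
    by (simp add: unit_tangent_def arclength_deriv_def curve_deriv_binormal norm_principal_normal
        sgn_real_def abs_mult field_simps)
  have "connected (t ` I)"
    using assms(2) continuous_torsion by (simp add: connected_continuous_image is_interval_connected)
  then have "(\<forall>s\<in>I. t s > 0) \<or> (\<forall>s\<in>I. t s < 0)"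
    using assms(4) by (smt (verit, best) connectedD_interval imageE imageI)
  then show thesis
  proof
    assume "\<forall>s\<in>I. t s > 0"
    then show thesis using tangent that[of "- 1"] by simp
  next
    assume "\<forall>s\<in>I. t s < 0"
    then show thesis using tangent that[of 1] by simp
  qed
qed

text \<open>
  The indicatrix is regular because the torsion does not vanish, and its curvature is positive
  because its tangent is \<open>N\<close> up to a constant sign and \<open>N' \<noteq> 0\<close>.
\<close>

lemma frenet_curve_binormal_indicatrix:
  assumes "open I" "is_interval I" "frenet_curve_on I \<beta>" "\<And>s. s \<in> I \<Longrightarrow> torsion \<beta> s \<noteq> 0"
  shows "frenet_curve_on I (binormal \<beta>)"
proof -
  interpret frenet_curve I \<beta> using assms by unfold_locales
  obtain e :: real where e: "e * e = 1" "\<And>s. s \<in> I \<Longrightarrow> unit_tangent B s = e *\<^sub>R N s"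
    using unit_tangent_binormal_indicatrix[OF assms] by blast
  have regular: "curve_deriv B s \<noteq> 0" if "s \<in> I" for s
    using that assms(4) speed_pos[OF that] norm_principal_normal[OF that]
    by (auto simp: curve_deriv_binormal)
  have "curve_deriv (unit_tangent B) s = e *\<^sub>R curve_deriv N s" if "s \<in> I" for s
  proof (rule curve_deriv_eqI, rule has_vector_derivative_cong_open[OF open_I that])
    show "((\<lambda>s. e *\<^sub>R N s) has_vector_derivative e *\<^sub>R curve_deriv N s) (at s)"
      by (intro bounded_linear.has_vector_derivative[OF bounded_linear_scaleR_right]
          smooth_on_has_curve_deriv[OF smooth_principal_normal that])
  qed (simp add: e)
  then have "arclength_deriv B (unit_tangent B) s \<noteq> 0" if "s \<in> I" for s
    using that regular[OF that] curve_deriv_principal_normal_nonzero[OF that] e(1)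
    by (auto simp: arclength_deriv_def)
  then have "curvature B s > 0" if "s \<in> I" for s
    using that by (simp add: curvature_def)
  then show ?thesis
    using regular smooth_binormal open_I
    by (simp add: frenet_curve_on_def smooth_curve_on_iff_smooth_on)
qed

lemma binormal_indicatrix_spherical_helix_iff:
  assumes "open I" "is_interval I" "frenet_curve_on I \<beta>" "\<And>s. s \<in> I \<Longrightarrow> torsion \<beta> s \<noteq> 0"
  shows "spherical_helix_on I (binormal \<beta>) \<longleftrightarrow> slant_helix_on I \<beta>"
proof -
  interpret frenet_curve I \<beta> using assms by unfold_locales
  obtain e :: real where e: "e * e = 1" "\<And>s. s \<in> I \<Longrightarrow> unit_tangent B s = e *\<^sub>R N s"
    using unit_tangent_binormal_indicatrix[OF assms] by blast
  have abs_e: "\<bar>e\<bar> = 1" using e(1) by (auto simp: square_eq_1_iff)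
  have "\<forall>s\<in>I. B s \<in> sphere 0 1"
    using inner_binormal_self by (simp add: norm_eq_sqrt_inner)
  then have "spherical_helix_on I B \<longleftrightarrow>
      (\<exists>d \<theta>. norm d = 1 \<and> (\<forall>s\<in>I. inner (unit_tangent B s) d = cos \<theta>))"
    using lancret[OF assms(1,2) frenet_curve_binormal_indicatrix[OF assms]]
    by (auto simp: spherical_helix_on_def)
  \<comment> \<open>The sign is absorbed by reversing the axis, so that the angle is the same for both curves.\<close>
  also have "\<dots> \<longleftrightarrow> (\<exists>d \<theta>. norm d = 1 \<and> (\<forall>s\<in>I. inner (N s) d = cos \<theta>))"
  proof (intro iffI; elim exE conjE)
    fix d \<theta> assume "norm d = 1" "\<forall>s\<in>I. inner (unit_tangent B s) d = cos \<theta>"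
    then show "\<exists>d \<theta>. norm d = 1 \<and> (\<forall>s\<in>I. inner (N s) d = cos \<theta>)"
      using e abs_e by (intro exI[of _ "e *\<^sub>R d"] exI[of _ \<theta>]) simp
  next
    fix d \<theta> assume "norm d = 1" "\<forall>s\<in>I. inner (N s) d = cos \<theta>"
    then show "\<exists>d \<theta>. norm d = 1 \<and> (\<forall>s\<in>I. inner (unit_tangent B s) d = cos \<theta>)"
      using e abs_e by (intro exI[of _ "e *\<^sub>R d"] exI[of _ \<theta>]) (simp add: mult.assoc[symmetric])
  qed
  also have "\<dots> \<longleftrightarrow> slant_helix_on I \<beta>"
    using assms(3) by (simp add: slant_helix_on_def)
  finally show ?thesis .
qed

section \<open>Involutes\<close>

text \<open>
  In the derivative of \<open>\<gamma> + (c - s) T\<close> the two terms \<open>T\<close> cancel and \<open>(c - s) k N\<close> is left. Thus the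
  tangent of the involute is \<open>N\<close>, with \<open>c - s > 0\<close> fixing the sign, and the curvature of the involute is
  \<open>norm N'\<close> divided by the speed, which is positive.
\<close>

lemma frenet_curve_involute:
  assumes "open I" "frenet_curve_on I \<gamma>" "arclength_parametrized_on I \<gamma>"
    and "\<And>s. s \<in> I \<Longrightarrow> c - s > 0"
  shows "frenet_curve_on I (involute c \<gamma>)"
proof -
  interpret frenet_curve I \<gamma> using assms by unfold_locales
  let ?\<beta> = "involute c \<gamma>"
  have v: "v s = 1" if "s \<in> I" for s
    using assms(3) that by (simp add: arclength_parametrized_on_def)
  have smooth_involute: "smooth_on I ?\<beta>"
  proof -
    have "smooth_on I (\<lambda>s. \<gamma> s + (c + (- 1) * s) *\<^sub>R T s)"
      by (intro smooth_on_add smooth_on_scaleR smooth_on_mult smooth_on_const smooth_on_ident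
          smooth smooth_unit_tangent)
    then show ?thesis by (simp add: involute_def[abs_def])
  qed
  have deriv: "curve_deriv ?\<beta> s = ((c - s) * k s) *\<^sub>R N s" if "s \<in> I" for s
  proof (rule curve_deriv_eqI)
    have "curve_deriv \<gamma> s = T s"
      using v[OF that] by (simp add: unit_tangent_def arclength_deriv_def)
    then have "(\<gamma> has_vector_derivative T s) (at s)"
      using smooth_on_has_curve_deriv[OF smooth that] by simp
    moreover have "((\<lambda>x. c - x) has_vector_derivative - 1) (at s)"
      by (auto intro!: derivative_eq_intros)
    moreover have "(T has_vector_derivative k s *\<^sub>R N s) (at s)"
      using smooth_on_has_curve_deriv[OF smooth_unit_tangent that]
      by (simp add: curve_deriv_unit_tangent[OF that] v[OF that])
    ultimately have "((\<lambda>x. \<gamma> x + (c - x) *\<^sub>R T x) has_vector_derivative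
        (T s + ((c - s) *\<^sub>R (k s *\<^sub>R N s) + (- 1) *\<^sub>R T s))) (at s)"
      by (intro has_vector_derivative_add
          bounded_bilinear.has_vector_derivative[OF bounded_bilinear_scaleR])
    then show "(?\<beta> has_vector_derivative ((c - s) * k s) *\<^sub>R N s) (at s)"
      by (simp add: involute_def[abs_def])
  qed
  have speed: "norm (curve_deriv ?\<beta> s) = (c - s) * k s" and pos: "(c - s) * k s > 0"
    if "s \<in> I" for s
    using assms(4)[OF that] curvature_pos[OF that]
    by (simp_all add: deriv that norm_principal_normal)
  have tangent: "unit_tangent ?\<beta> s = N s" if "s \<in> I" for s
  proof -
    have "unit_tangent ?\<beta> s = (inverse ((c - s) * k s) * ((c - s) * k s)) *\<^sub>R N s"
      unfolding unit_tangent_def arclength_deriv_def speed[OF that]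
      by (simp only: deriv[OF that] scaleR_scaleR)
    also have "inverse ((c - s) * k s) * ((c - s) * k s) = 1"
      by (rule left_inverse[OF less_imp_neq[OF pos[OF that], symmetric]])
    finally show ?thesis by simp
  qed
  have "curve_deriv (unit_tangent ?\<beta>) s = curve_deriv N s" if "s \<in> I" for s
    by (rule curve_deriv_eqI, rule has_vector_derivative_cong_open[OF open_I that])
      (use tangent smooth_on_has_curve_deriv[OF smooth_principal_normal that] in auto)
  moreover have regular: "curve_deriv ?\<beta> s \<noteq> 0" if "s \<in> I" for s
    using speed[OF that] pos[OF that] by auto
  ultimately have "arclength_deriv ?\<beta> (unit_tangent ?\<beta>) s \<noteq> 0" if "s \<in> I" for s
    using curve_deriv_principal_normal_nonzero[OF that] that by (simp add: arclength_deriv_def)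
  then have "curvature ?\<beta> s > 0" if "s \<in> I" for s
    using that by (simp add: curvature_def)
  then show ?thesis
    using regular smooth_involute open_I
    by (simp add: frenet_curve_on_def smooth_curve_on_iff_smooth_on)
qed

theorem theorem12:
  fixes \<gamma> :: "real \<Rightarrow> real ^ 3" and I :: "real set" and c :: real
  assumes "open I" and "is_interval I" and "I \<noteq> {}"
    and "smooth_curve_on I \<gamma>"
    and "arclength_parametrized_on I \<gamma>"
    and "\<And>s. s \<in> I \<Longrightarrow> curvature \<gamma> s \<noteq> 0"
    and "\<And>s. s \<in> I \<Longrightarrow> c - s > 0"
    and "\<And>s. s \<in> I \<Longrightarrow> torsion (involute c \<gamma>) s \<noteq> 0"
  shows "spherical_helix_on I (binormal_indicatrix (involute c \<gamma>)) \<longleftrightarrow>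
         slant_helix_on I (involute c \<gamma>)"
proof -
  have "curvature \<gamma> s > 0" if "s \<in> I" for s
    using assms(6)[OF that] by (simp add: curvature_def)
  moreover have "curve_deriv \<gamma> s \<noteq> 0" if "s \<in> I" for s
    using assms(5) that by (auto simp: arclength_parametrized_on_def)
  ultimately have "frenet_curve_on I \<gamma>"
    using assms(4) by (simp add: frenet_curve_on_def)
  then have "frenet_curve_on I (involute c \<gamma>)"
    using frenet_curve_involute assms(1,5,7) by blast
  then show ?thesis
    using binormal_indicatrix_spherical_helix_iff assms(1,2,8) by blast
qed

end
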